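(* Let $T^*:[0,1]^2\to[0,1]$ be an associative monotone function with a neutral element in $[0,1]$. Let $M\in\mathcal{A}$ be the range of a non-constant non-decreasing right continuous function $f:[0,1]\to[0,1]$ with $f(1)<1$, and let $(\mathcal{S},\mathcal{C})=(\{[b_k,d_k]\mid k\in K\},\{c_k\mid k\in\overline{K}\})$ be associated with $M$. Then $(M,\otimes)$ is a semigroup (i.e. the operation $\otimes$ on $M$ is associative) if and only if $I(M)\cap(M\setminus\{f(1)\})=\emptyset$.
   Context: $\mathcal{A}$ is the family of all sets $M\subseteq[0,1]$ for which there is a non-decreasing right continuous function $f:[0,1]\to[0,1]$ with $\mathrm{Ran}(f)=M$; then $f(1)=\max M$. A pair $(\mathcal{S},\mathcal{C})$ is associated with $M\in\mathcal{A}$, $M\neq[0,f(1)]$, if: $\mathcal{S}=\{[b_k,d_k]\subseteq[0,1]\mid k\in K\}$ is a non-empty countable (possibly finite) system of closed intervals of positive length such that for any two distinct members $[b_k,d_k],[b_l,d_l]$ either $[b_k,d_k]\cap[b_l,d_l]=\emptyset$, or $[b_k,d_k]\cap[b_l,d_l]=\{d_k\}$ when $d_k\le b_l$; $\mathcal{C}=\{c_k\in[0,1]\mid k\in\overline{K}\}$ is a non-empty countable set such that for all $k\in K$, $[b_k,d_k]\cap\mathcal{C}=\{d_k\}$ or $[b_k,d_k]\cap\mathcal{C}=\{b_k,d_k\}$; and $M=\{c_k\mid k\in\overline{K}\}\cup\big([0,f(1)]\setminus\bigcup_{k\in K}[b_k,d_k]\big)$. If $M=[0,f(1)]$, the associated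 pair is $\mathcal{S}=\{[f(1),f(1)]\}$, $\mathcal{C}=\{f(1)\}$. "Monotone" for $T^*$ means non-decreasing in each variable, or non-increasing in each variable. $G_M:[0,1]\to M$ is $G_M(x)=\inf([x,1]\cap M)$ if $x<f(1)$ and $G_M(x)=f(1)$ otherwise. The operation $\otimes:M^2\to M$ is $x\otimes y=G_M(T^*(x,y))$. For $A\subseteq[0,1]$, $O(A)=\bigcup_{x,y\in A}[\min\{x,y\},\max\{x,y\})$ (with $[x,x)=\emptyset$), and $O(\emptyset)=\emptyset$. For $A\subseteq[0,1]$ and $c\in[0,1]$, $T^*(A,c)=\{T^*(x,c)\mid x\in A\}$ and $T^*(c,A)=\{T^*(c,x)\mid x\in A\}$ (empty if $A$ is empty). Let $K'=K\cup\{\tau\}$ with $\tau\notin K$. For $y\in M$ and $k,l\in K$: $\mathfrak{M}_k^y=\{x\in M\mid T^*(x,y)\in(b_k,d_k)\text{ if } b_k\in M,\ T^*(x,y)\in[b_k,d_k)\text{ if } b_k\notin M\}$; $\mathfrak{M}_\tau^y=\{x\in M\mid f(1)\le T^*(x,y)\}$; $\mathfrak{M}_y^k=\{x\in M\mid T^*(y,x)\in(b_k,d_k)\text{ if } b_k\in M,\ T^*(y,x)\in[b_k,d_k)\text{ if } b_k\notin M\}$; $\mathfrak{M}_y^\tau=\{x\in M\mid f(1)\le T^*(y,x)\}$; $\mathfrak{M}^y=\{x\in M\mid T^*(x,y)\in M\setminus\{f(1)\}\}$; $\mathfrak{M}_y=\{x\in M\mid T^*(y,x)\in M\setminus\{f(1)\}\}$;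 $\mathfrak{I}_k^y=\{d_k\}\cup T^*(\mathfrak{M}_k^y,y)$; $\mathfrak{I}_\tau^y=\{f(1)\}\cup T^*(\mathfrak{M}_\tau^y,y)$; $\mathfrak{I}_y^k=\{d_k\}\cup T^*(y,\mathfrak{M}_y^k)$; $\mathfrak{I}_y^\tau=\{f(1)\}\cup T^*(y,\mathfrak{M}_y^\tau)$; $\mathfrak{J}_{k,l}^y=O(T^*(\mathfrak{M}_k^y,d_l)\cup T^*(d_k,\mathfrak{M}_y^l))$ if $\mathfrak{M}_k^y\ne\emptyset$ and $\mathfrak{M}_y^l\ne\emptyset$, else $\emptyset$; $\mathfrak{J}_{\tau,l}^y=O(T^*(\mathfrak{M}_\tau^y,d_l)\cup T^*(f(1),\mathfrak{M}_y^l))$ if $\mathfrak{M}_\tau^y\ne\emptyset$ and $\mathfrak{M}_y^l\ne\emptyset$, else $\emptyset$; $\mathfrak{J}_{k,\tau}^y=O(T^*(\mathfrak{M}_k^y,f(1))\cup T^*(d_k,\mathfrak{M}_y^\tau))$ if $\mathfrak{M}_k^y\ne\emptyset$ and $\mathfrak{M}_y^\tau\ne\emptyset$, else $\emptyset$; $\mathfrak{J}_{\tau,\tau}^y=O(T^*(\mathfrak{M}_\tau^y,f(1))\cup T^*(f(1),\mathfrak{M}_y^\tau))$ if $\mathfrak{M}_\tau^y\ne\emptyset$ and $\mathfrak{M}_y^\tau\ne\emptyset$, else $\emptyset$. $I_1(M)=\bigcup_{y\in M}\bigcup_{k\in K'}\bigcup_{t\in\mathfrak{M}_y}O(T^*(\mathfrak{I}_k^y,t))$;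 $I_2(M)=\bigcup_{y\in M}\bigcup_{k\in K'}\bigcup_{t\in\mathfrak{M}^y}O(T^*(t,\mathfrak{I}_y^k))$; $I_3(M)=\bigcup_{y\in M}\bigcup_{k,l\in K'}\mathfrak{J}_{k,l}^y$; $I(M)=I_1(M)\cup I_2(M)\cup I_3(M)$. *)

theory Defs
  imports "HOL-Analysis.Analysis"
begin

definition semigroup_on :: "'a set \<Rightarrow> ('a \<Rightarrow> 'a \<Rightarrow> 'a) \<Rightarrow> bool" where
  "semigroup_on A p \<longleftrightarrow>
     (\<forall>x\<in>A. \<forall>y\<in>A. p x y \<in> A) \<and>
     (\<forall>x\<in>A. \<forall>y\<in>A. \<forall>z\<in>A. p (p x y) z = p x (p y z))"

definition neutral_on :: "'a set \<Rightarrow> ('a \<Rightarrow> 'a \<Rightarrow> 'a) \<Rightarrow> 'a \<Rightarrow> bool" where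
  "neutral_on A p e \<longleftrightarrow> e \<in> A \<and> (\<forall>x\<in>A. p e x = x \<and> p x e = x)"

definition monotone_op_on :: "real set \<Rightarrow> (real \<Rightarrow> real \<Rightarrow> real) \<Rightarrow> bool" where
  "monotone_op_on A p \<longleftrightarrow>
     (\<forall>y\<in>A. mono_on A (\<lambda>x. p x y)) \<and> (\<forall>x\<in>A. mono_on A (\<lambda>y. p x y)) \<or>
     (\<forall>y\<in>A. antimono_on A (\<lambda>x. p x y)) \<and> (\<forall>x\<in>A. antimono_on A (\<lambda>y. p x y))"

(* Functions [0,1] -> [0,1] are represented by total functions on the reals of which only the
   values on [0,1] matter; right continuity is a condition at the points of [0,1). *)
definition nondecreasing_rcont :: "(real \<Rightarrow> real) \<Rightarrow> bool" where
  "nondecreasing_rcont f \<longleftrightarrow>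
     f \<in> {0..1} \<rightarrow> {0..1} \<and> mono_on {0..1} f \<and> (\<forall>x\<in>{0..<1}. continuous (at_right x) f)"

(* Here and below m stands for f(1), the maximum of M = Ran(f).  The system S is the family of
   the intervals [b k, d k] for k in K; in the case M = [0, m] it consists of the single
   degenerate interval [m, m]. *)
definition associated_pair ::
    "real set \<Rightarrow> real \<Rightarrow> 'k set \<Rightarrow> ('k \<Rightarrow> real) \<Rightarrow> ('k \<Rightarrow> real) \<Rightarrow> real set \<Rightarrow> bool" where
  "associated_pair M m K b d C \<longleftrightarrow>
     K \<noteq> {} \<and> countable K \<and>
     (if M = {0..m} then (\<forall>k\<in>K. b k = m \<and> d k = m) \<and> C = {m}
      else
        (\<forall>k\<in>K. 0 \<le> b k \<and> b k < d k \<and> d k \<le> 1) \<and>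
        (\<forall>k\<in>K. \<forall>l\<in>K. {b k..d k} \<noteq> {b l..d l} \<longrightarrow>
           {b k..d k} \<inter> {b l..d l} = {} \<or>
           d k \<le> b l \<and> {b k..d k} \<inter> {b l..d l} = {d k} \<or>
           d l \<le> b k \<and> {b k..d k} \<inter> {b l..d l} = {d l}) \<and>
        C \<noteq> {} \<and> countable C \<and> C \<subseteq> {0..1} \<and>
        (\<forall>k\<in>K. {b k..d k} \<inter> C = {d k} \<or> {b k..d k} \<inter> C = {b k, d k}) \<and>
        M = C \<union> ({0..m} - (\<Union>k\<in>K. {b k..d k})))"

definition O_set :: "real set \<Rightarrow> real set" where
  "O_set A = (\<Union>x\<in>A. \<Union>y\<in>A. {min x y..<max x y})"

context
  fixes T :: "real \<Rightarrow> real \<Rightarrow> real" and M :: "real set" and m :: real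
begin

definition G_fun :: "real \<Rightarrow> real" where
  "G_fun x = (if x < m then Inf ({x..1} \<inter> M) else m)"

definition otimes :: "real \<Rightarrow> real \<Rightarrow> real" where
  "otimes x y = G_fun (T x y)"

definition M_upper :: "real \<Rightarrow> real set" where
  "M_upper y = {x\<in>M. T x y \<in> M - {m}}"

definition M_lower :: "real \<Rightarrow> real set" where
  "M_lower y = {x\<in>M. T y x \<in> M - {m}}"

context
  fixes K :: "'k set" and b d :: "'k \<Rightarrow> real"
begin

(* The index set K' = K + {tau} is modelled by the option type, with None for tau.
   All constructions below treat m as the right end point belonging to tau. *)
definition K_ext :: "'k option set" where
  "K_ext = insert None (Some ` K)"

definition right_end :: "'k option \<Rightarrow> real" where
  "right_end k = (case k of None \<Rightarrow> m | Some j \<Rightarrow> d j)"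

(* Membership in region k: the gap of M belonging to the interval with index k,
   or everything from m on if k is tau. *)
definition region :: "'k option \<Rightarrow> real set" where
  "region k = (case k of None \<Rightarrow> {m..}
     | Some j \<Rightarrow> if b j \<in> M then {b j<..<d j} else {b j..<d j})"

(* Suffix _l: the varying element is the left argument of T (superscript y in the usual notation);
   suffix _r: it is the right argument (subscript y). *)
definition M_l :: "'k option \<Rightarrow> real \<Rightarrow> real set" where
  "M_l k y = {x\<in>M. T x y \<in> region k}"

definition M_r :: "'k option \<Rightarrow> real \<Rightarrow> real set" where
  "M_r k y = {x\<in>M. T y x \<in> region k}"

definition I_l :: "'k option \<Rightarrow> real \<Rightarrow> real set" where
  "I_l k y = insert (right_end k) ((\<lambda>x. T x y) ` M_l k y)"

definition I_r :: "'k option \<Rightarrow> real \<Rightarrow> real set" where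
  "I_r k y = insert (right_end k) ((\<lambda>x. T y x) ` M_r k y)"

definition J_set :: "'k option \<Rightarrow> 'k option \<Rightarrow> real \<Rightarrow> real set" where
  "J_set k l y =
     (if M_l k y \<noteq> {} \<and> M_r l y \<noteq> {}
      then O_set ((\<lambda>x. T x (right_end l)) ` M_l k y \<union> (\<lambda>x. T (right_end k) x) ` M_r l y)
      else {})"

definition I1 :: "real set" where
  "I1 = (\<Union>y\<in>M. \<Union>k\<in>K_ext. \<Union>t\<in>M_lower y. O_set ((\<lambda>x. T x t) ` I_l k y))"

definition I2 :: "real set" where
  "I2 = (\<Union>y\<in>M. \<Union>k\<in>K_ext. \<Union>t\<in>M_upper y. O_set ((\<lambda>x. T t x) ` I_r k y))"

definition I3 :: "real set" where
  "I3 = (\<Union>y\<in>M. \<Union>k\<in>K_ext. \<Union>l\<in>K_ext. J_set k l y)"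

definition I_set :: "real set" where
  "I_set = I1 \<union> I2 \<union> I3"

end

end

end

theory Submission
  imports Defs
begin

text \<open>
  Write \<open>G\<close> for the map that sends a number to the least element of \<open>M\<close> not below it, and everything
  beyond the maximum \<open>m\<close> of \<open>M\<close> to \<open>m\<close>; the operation under study is \<open>x \<otimes> y = G (T x y)\<close>.

  The whole argument is a dictionary between \<open>O_set\<close> and \<open>G\<close>: a set \<open>O_set A\<close> avoids \<open>M - {m}\<close>
  exactly when \<open>G\<close> is constant on \<open>A\<close>, because two points have different images under \<open>G\<close> exactly
  when an element of \<open>M - {m}\<close> separates them (lemma \<open>O_set_avoids_iff\<close>). The unit interval is
  covered by \<open>M - {m}\<close>, where \<open>G\<close> is the identity, and the regions, which avoid \<open>M - {m}\<close>, and \<open>G\<close> collapses each region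
  to its right end point. So for \<open>x, y, z\<close> in \<open>M\<close> there are four cases, according to whether
  \<open>T x y\<close> and \<open>T y z\<close> lie in \<open>M - {m}\<close> or in a region.

  If both lie in \<open>M - {m}\<close>, associativity of \<open>T\<close> passes directly to \<open>\<otimes>\<close>. If only \<open>T y z\<close> does, then
  \<open>x \<otimes> (y \<otimes> z)\<close> is \<open>G (T (T x y) z)\<close> and \<open>(x \<otimes> y) \<otimes> z\<close> is \<open>G (T r z)\<close>, where \<open>r\<close> is the right end of
  the region of \<open>T x y\<close>; by the dictionary all these equations together say that \<open>I1\<close> avoids
  \<open>M - {m}\<close>. The third case is the mirror image and gives \<open>I2\<close>. If both products lie in regions,
  the two bracketings are the values of \<open>G\<close> at the points that generate the sets \<open>J_set\<close>, and
  one obtains \<open>I3\<close>.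
\<close>

section \<open>The projection onto a set closed under infima\<close>

locale inf_closed_set =
  fixes M :: "real set" and m :: real
  assumes M_subset: "M \<subseteq> {0..m}"
    and max_mem: "m \<in> M"
    and max_le_1: "m \<le> 1"
    and Inf_mem: "\<And>A. A \<subseteq> M \<Longrightarrow> A \<noteq> {} \<Longrightarrow> Inf A \<in> M"
begin

abbreviation G :: "real \<Rightarrow> real" where
  "G \<equiv> G_fun M m"

lemma le_max: "x \<in> M \<Longrightarrow> x \<le> m"
  using M_subset by auto

lemma M_subset_unit: "x \<in> M \<Longrightarrow> x \<in> {0..1}"
  using M_subset max_le_1 by force

lemma G_mem: "G x \<in> M"
proof (cases "x < m")
  case True
  then have "m \<in> {x..1} \<inter> M"
    using max_mem max_le_1 by auto
  then have "Inf ({x..1} \<inter> M) \<in> M"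
    by (intro Inf_mem) auto
  with True show ?thesis by (simp add: G_fun_def)
qed (simp add: G_fun_def max_mem)

lemma G_upper:
  assumes "x \<le> m"
  shows "x \<le> G x"
proof (cases "x < m")
  case True
  then have "m \<in> {x..1} \<inter> M"
    using max_mem max_le_1 by simp
  then have "x \<le> Inf ({x..1} \<inter> M)"
    by (intro cInf_greatest) (blast, simp)
  with True show ?thesis by (simp add: G_fun_def)
next
  case False
  with assms show ?thesis by (simp add: G_fun_def)
qed

lemma G_least:
  assumes "u \<in> M" "x \<le> u"
  shows "G x \<le> u"
proof (cases "x < m")
  case True
  have "u \<in> {x..1} \<inter> M"
    using assms M_subset_unit[of u] by simp
  moreover have "bdd_below ({x..1} \<inter> M)"
    by (rule bdd_belowI[of _ x]) simp
  ultimately have "Inf ({x..1} \<inter> M) \<le> u"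
    by (rule cInf_lower)
  with True show ?thesis by (simp add: G_fun_def)
next
  case False
  with assms show ?thesis by (simp add: G_fun_def)
qed

lemma G_ident: "u \<in> M \<Longrightarrow> G u = u"
  using G_least[of u u] G_upper[of u] le_max[of u] by auto

lemma G_less_imp_separated:
  assumes "G x < G y"
  shows "G x \<in> {x..<y} \<inter> (M - {m})"
proof -
  have "G x < m"
    using assms le_max[OF G_mem] by (rule less_le_trans)
  then have "x \<le> m"
    by (auto simp: G_fun_def split: if_splits)
  moreover have "G x < y"
    using assms G_least[OF G_mem, of y x] by (meson not_less)
  ultimately show ?thesis
    using \<open>G x < m\<close> G_upper G_mem by auto
qed

lemma separated_imp_G_less:
  assumes "u \<in> M - {m}" "x \<le> u" "u < y"
  shows "G x < G y"
proof -
  have "u < m"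
    using assms(1) le_max[of u] by auto
  then have "u < G y"
    using assms(3) G_upper[of y] by (cases "y \<le> m") (auto simp: G_fun_def)
  with G_least[of u x] assms show ?thesis by auto
qed

text \<open>
  For \<open>x < y\<close> the values \<open>G x\<close> and \<open>G y\<close> differ if and only if \<open>[x, y)\<close> contains an element of
  \<open>M - {m}\<close>; if they differ, \<open>G x\<close> itself is such an element. The maximum is excluded since \<open>G\<close> sends everything beyond it to \<open>m\<close>, so it
  separates nothing.
\<close>

lemma O_set_avoids_iff:
  "O_set A \<inter> (M - {m}) = {} \<longleftrightarrow> (\<forall>x\<in>A. \<forall>y\<in>A. G x = G y)"
proof
  assume *: "O_set A \<inter> (M - {m}) = {}"
  have "\<not> G x < G y" if "x \<in> A" "y \<in> A" for x y
  proof
    assume "G x < G y"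
    from G_less_imp_separated[OF this] have "G x \<in> {min x y..<max x y}" "G x \<in> M - {m}"
      by auto
    then show False
      using * that unfolding O_set_def by blast
  qed
  then show "\<forall>x\<in>A. \<forall>y\<in>A. G x = G y"
    by (meson linorder_neqE)
next
  assume *: "\<forall>x\<in>A. \<forall>y\<in>A. G x = G y"
  have False if "x \<in> A" "y \<in> A" "u \<in> {min x y..<max x y}" "u \<in> M - {m}" for x y u
  proof -
    have "G (min x y) < G (max x y)"
      using that by (intro separated_imp_G_less[of u]) auto
    moreover have "min x y \<in> A" "max x y \<in> A"
      using that by (auto simp: min_def max_def)
    ultimately show False
      using * by (metis less_irrefl)
  qed
  then show "O_set A \<inter> (M - {m}) = {}"
    unfolding O_set_def by blast
qed

lemma O_set_insert_avoids_iff: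
  "O_set (insert r A) \<inter> (M - {m}) = {} \<longleftrightarrow> (\<forall>x\<in>A. G x = G r)"
  unfolding O_set_avoids_iff by (metis insert_iff)

end

text \<open>
  By monotonicity and right continuity, the infimum of a set \<open>A\<close> of values is the value of \<open>f\<close> at the
  infimum of the preimage of \<open>A\<close>.
\<close>

lemma Inf_mem_range_rcont:
  assumes f: "nondecreasing_rcont f" and A: "A \<subseteq> f ` {0..1}" "A \<noteq> {}"
  shows "Inf A \<in> f ` {0..1}"
proof -
  define B where "B = {t \<in> {0..1}. f t \<in> A}"
  have B_sub: "B \<subseteq> {0..1}" and B_ne: "B \<noteq> {}" and fB: "f ` B = A"
    using A unfolding B_def by auto
  have bdd: "bdd_below B"
    using B_sub by (intro bdd_belowI[of B 0]) auto
  define s where "s = Inf B"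
  have s_le: "s \<le> t" if "t \<in> B" for t
    unfolding s_def using bdd that by (rule cInf_lower[rotated])
  have "0 \<le> s"
    unfolding s_def using B_sub B_ne by (intro cInf_greatest) auto
  moreover have "s \<le> 1"
    using s_le B_ne B_sub by force
  ultimately have s_unit: "s \<in> {0..1}" by simp
  have mono: "mono_on {0..1} f"
    using f by (simp add: nondecreasing_rcont_def)
  have lower: "f s \<le> a" if "a \<in> A" for a
    using that fB s_le s_unit B_sub mono_onD[OF mono] by blast
  have bddA: "bdd_below A"
    using lower by (rule bdd_belowI)
  have "Inf A = f s"
  proof (rule antisym)
    show "f s \<le> Inf A"
      using A(2) lower by (rule cInf_greatest)
    show "Inf A \<le> f s"
    proof (cases "s \<in> B")
      case True
      then have "f s \<in> A"
        using fB by blast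
      then show ?thesis
        using bddA by (rule cInf_lower)
    next
      case False
      from B_ne obtain t0 where "t0 \<in> B" by blast
      with False have "s < t0"
        using s_le by (metis order_le_less)
      with \<open>t0 \<in> B\<close> B_sub s_unit have "s \<in> {0..<1}" by auto
      then have lim: "(f \<longlongrightarrow> f s) (at_right s)"
        using f by (auto simp: nondecreasing_rcont_def continuous_within)
      show ?thesis
      proof (rule field_le_epsilon)
        fix e :: real assume "0 < e"
        then have "eventually (\<lambda>u. f u < f s + e) (at_right s)"
          using lim by (intro order_tendstoD(2)) auto
        then obtain c where c: "s < c" "\<And>u. s < u \<Longrightarrow> u < c \<Longrightarrow> f u < f s + e"
          by (auto simp: eventually_at_right_field)
        then obtain u where u: "u \<in> B" "u < c"
          using cInf_lessD[OF B_ne] unfolding s_def by blast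
        with False have "s < u"
          using s_le by (metis order_le_less)
        with c u have "f u < f s + e" by blast
        moreover have "f u \<in> A"
          using u fB by blast
        then have "Inf A \<le> f u"
          using bddA by (rule cInf_lower)
        ultimately show "Inf A \<le> f s + e" by simp
      qed
    qed
  qed
  with s_unit show ?thesis by blast
qed

lemma inf_closed_set_range:
  assumes f: "nondecreasing_rcont f"
  shows "inf_closed_set (f ` {0..1}) (f 1)"
proof
  have mono: "mono_on {0..1} f" and into: "f \<in> {0..1} \<rightarrow> {0..1}"
    using f by (auto simp: nondecreasing_rcont_def)
  show "f ` {0..1} \<subseteq> {0..f 1}"
    using mono_onD[OF mono, of _ 1] into by auto
  show "f 1 \<in> f ` {0..1}" "f 1 \<le> 1"
    using into by auto
  show "Inf A \<in> f ` {0..1}" if "A \<subseteq> f ` {0..1}" "A \<noteq> {}" for A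
    using Inf_mem_range_rcont[OF f that] .
qed

section \<open>Associativity of \<open>\<otimes>\<close> and the sets \<open>I1\<close>, \<open>I2\<close>, \<open>I3\<close>\<close>

text \<open>
  The gaps of an associated pair, seen from \<open>M\<close> alone: they fill \<open>[0, m] - M\<close>, and each one ends at a
  point of \<open>M\<close>, which is what makes \<open>G\<close> constant on it. All conditions on \<open>T\<close> are symmetric in its two
  arguments, so that results can be transferred to the opposite operation.
\<close>

locale gap_system = inf_closed_set M m
  for M :: "real set" and m :: real +
  fixes K :: "'k set" and b d :: "'k \<Rightarrow> real" and T :: "real \<Rightarrow> real \<Rightarrow> real"
  assumes right_mem: "\<And>k. k \<in> K \<Longrightarrow> d k \<in> M"
    and gap_disjoint: "\<And>k. k \<in> K \<Longrightarrow> region M m b d (Some k) \<inter> M = {}"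
    and gaps_cover: "\<And>x. x \<in> {0..m} - M \<Longrightarrow> \<exists>k\<in>K. x \<in> region M m b d (Some k)"
    and T_unit: "\<And>x y. x \<in> {0..1} \<Longrightarrow> y \<in> {0..1} \<Longrightarrow> T x y \<in> {0..1}"
    and T_assoc: "\<And>x y z. x \<in> {0..1} \<Longrightarrow> y \<in> {0..1} \<Longrightarrow> z \<in> {0..1} \<Longrightarrow> T (T x y) z = T x (T y z)"
begin

definition assoc_at :: "real \<Rightarrow> real \<Rightarrow> real \<Rightarrow> bool" where
  "assoc_at x y z \<longleftrightarrow>
     otimes T M m (otimes T M m x y) z = otimes T M m x (otimes T M m y z)"

lemma region_avoids: "k \<in> K_ext K \<Longrightarrow> region M m b d k \<inter> (M - {m}) = {}"
proof (cases k)
  case None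
  then show ?thesis
    using le_max by (auto simp: region_def intro: antisym)
next
  case (Some j)
  assume "k \<in> K_ext K"
  with Some have "j \<in> K"
    by (auto simp: K_ext_def)
  with Some gap_disjoint[of j] show ?thesis by blast
qed

lemma G_region:
  assumes "k \<in> K_ext K" "x \<in> region M m b d k"
  shows "G x = right_end m d k"
proof (cases k)
  case None
  with assms show ?thesis by (simp add: region_def right_end_def G_fun_def)
next
  case (Some j)
  with assms have j: "j \<in> K" and x: "x \<in> region M m b d (Some j)"
    by (auto simp: K_ext_def)
  from x have "x < d j"
    by (auto simp: region_def split: if_splits)
  then have "G x \<le> d j"
    using right_mem[OF j] by (intro G_least) auto
  moreover have "\<not> G x < d j"
  proof
    assume "G x < d j"
    moreover have "x \<le> G x"
      using \<open>x < d j\<close> right_mem[OF j] le_max by (intro G_upper) force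
    ultimately have "G x \<in> region M m b d (Some j)"
      using x by (auto simp: region_def split: if_splits)
    with gap_disjoint[OF j] G_mem show False by blast
  qed
  ultimately show ?thesis
    using Some by (simp add: right_end_def)
qed

lemma region_cover:
  assumes "x \<in> {0..1}" "x \<notin> M - {m}"
  obtains k where "k \<in> K_ext K" "x \<in> region M m b d k"
proof (cases "m \<le> x")
  case True
  then show ?thesis
    using that[of None] by (simp add: K_ext_def region_def)
next
  case False
  with assms gaps_cover[of x] obtain j where "j \<in> K" "x \<in> region M m b d (Some j)"
    by auto
  then show ?thesis
    using that[of "Some j"] by (simp add: K_ext_def)
qed

lemma assoc_at_if_products_mem:
  assumes "x \<in> M" "y \<in> M" "z \<in> M" "T x y \<in> M" "T y z \<in> M"
  shows "assoc_at x y z"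
  using assms T_assoc[of x y z] M_subset_unit by (simp add: assoc_at_def otimes_def G_ident)

lemma assoc_at_iff_left_region:
  assumes "x \<in> M" "y \<in> M" "z \<in> M" "T y z \<in> M"
    and "k \<in> K_ext K" "T x y \<in> region M m b d k"
  shows "assoc_at x y z \<longleftrightarrow> G (T (T x y) z) = G (T (right_end m d k) z)"
  using assms T_assoc[of x y z] M_subset_unit
  by (auto simp: assoc_at_def otimes_def G_ident G_region)

lemma assoc_at_iff_both_regions:
  assumes "k \<in> K_ext K" "T x y \<in> region M m b d k"
    and "l \<in> K_ext K" "T y z \<in> region M m b d l"
  shows "assoc_at x y z \<longleftrightarrow> G (T (right_end m d k) z) = G (T x (right_end m d l))"
  using assms by (simp add: assoc_at_def otimes_def G_region)

text \<open>
  For fixed \<open>y\<close>, \<open>k\<close>, \<open>t\<close> the generators \<open>T (T x y) t\<close> of \<open>I1\<close> are compared with the single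
  generator \<open>T r t\<close>, where \<open>r\<close> is the right end of region \<open>k\<close>; \<open>G\<close> is constant on all of them if and
  only if each of these comparisons succeeds.
\<close>

lemma I1_avoids_iff:
  "I1 T M m K b d \<inter> (M - {m}) = {} \<longleftrightarrow>
     (\<forall>x\<in>M. \<forall>y\<in>M. \<forall>z\<in>M. T x y \<notin> M - {m} \<longrightarrow> T y z \<in> M - {m} \<longrightarrow> assoc_at x y z)"
  (is "?L \<longleftrightarrow> ?R")
proof -
  have "?L \<longleftrightarrow> (\<forall>y\<in>M. \<forall>k\<in>K_ext K. \<forall>t\<in>M_lower T M m y.
      O_set ((\<lambda>x. T x t) ` I_l T M m b d k y) \<inter> (M - {m}) = {})"
    unfolding I1_def by blast
  also have "\<dots> \<longleftrightarrow> (\<forall>y\<in>M. \<forall>k\<in>K_ext K. \<forall>t\<in>M_lower T M m y. \<forall>x\<in>M_l T M m b d k y.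
      G (T (T x y) t) = G (T (right_end m d k) t))"
    unfolding I_l_def image_insert O_set_insert_avoids_iff by simp
  also have "\<dots> \<longleftrightarrow> (\<forall>y\<in>M. \<forall>k\<in>K_ext K. \<forall>t\<in>M_lower T M m y. \<forall>x\<in>M_l T M m b d k y.
      assoc_at x y t)"
    using assoc_at_iff_left_region by (intro ball_cong refl) (auto simp: M_l_def M_lower_def)
  also have "\<dots> \<longleftrightarrow> ?R"
  proof
    assume *: "\<forall>y\<in>M. \<forall>k\<in>K_ext K. \<forall>t\<in>M_lower T M m y. \<forall>x\<in>M_l T M m b d k y. assoc_at x y t"
    show ?R
    proof (intro ballI impI)
      fix x y z assume xyz: "x \<in> M" "y \<in> M" "z \<in> M" "T x y \<notin> M - {m}" "T y z \<in> M - {m}"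
      then obtain k where "k \<in> K_ext K" "T x y \<in> region M m b d k"
        using region_cover[OF T_unit] M_subset_unit by metis
      with * xyz show "assoc_at x y z"
        by (auto simp: M_l_def M_lower_def)
    qed
  next
    assume ?R
    then show "\<forall>y\<in>M. \<forall>k\<in>K_ext K. \<forall>t\<in>M_lower T M m y. \<forall>x\<in>M_l T M m b d k y. assoc_at x y t"
      using region_avoids unfolding M_l_def M_lower_def by blast
  qed
  finally show ?thesis .
qed

text \<open>
  Here the generators are of two kinds, \<open>T x (right end of l)\<close> and \<open>T (right end of k) z\<close>, with
  \<open>x\<close> and \<open>z\<close> varying independently. Associativity compares only generators of different kinds, but
  \<open>J_set\<close> is empty unless both kinds occur, and then one generator of the other kind links any two
  of the same kind, so that \<open>G\<close> is constant on all of them.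
\<close>

lemma I3_avoids_iff:
  "I3 T M m K b d \<inter> (M - {m}) = {} \<longleftrightarrow>
     (\<forall>x\<in>M. \<forall>y\<in>M. \<forall>z\<in>M. T x y \<notin> M - {m} \<longrightarrow> T y z \<notin> M - {m} \<longrightarrow> assoc_at x y z)"
  (is "?L \<longleftrightarrow> ?R")
proof -
  have J: "J_set T M m b d k l y \<inter> (M - {m}) = {} \<longleftrightarrow>
      (\<forall>x\<in>M_l T M m b d k y. \<forall>z\<in>M_r T M m b d l y. assoc_at x y z)"
    if k: "k \<in> K_ext K" and l: "l \<in> K_ext K" for k l y
  proof -
    let ?X = "M_l T M m b d k y" and ?Z = "M_r T M m b d l y"
    let ?p = "\<lambda>x. T x (right_end m d l)" and ?q = "\<lambda>z. T (right_end m d k) z"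
    have "J_set T M m b d k l y \<inter> (M - {m}) = {} \<longleftrightarrow>
        (?X \<noteq> {} \<and> ?Z \<noteq> {} \<longrightarrow> (\<forall>u\<in>?p ` ?X \<union> ?q ` ?Z. \<forall>v\<in>?p ` ?X \<union> ?q ` ?Z. G u = G v))"
      unfolding J_set_def O_set_avoids_iff[symmetric] by auto
    also have "\<dots> \<longleftrightarrow> (\<forall>x\<in>?X. \<forall>z\<in>?Z. G (?q z) = G (?p x))"
    proof
      assume *: "\<forall>x\<in>?X. \<forall>z\<in>?Z. G (?q z) = G (?p x)"
      show "?X \<noteq> {} \<and> ?Z \<noteq> {} \<longrightarrow>
          (\<forall>u\<in>?p ` ?X \<union> ?q ` ?Z. \<forall>v\<in>?p ` ?X \<union> ?q ` ?Z. G u = G v)"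
      proof
        assume "?X \<noteq> {} \<and> ?Z \<noteq> {}"
        then obtain x0 z0 where x0: "x0 \<in> ?X" and z0: "z0 \<in> ?Z" by blast
        have "G u = G (?q z0)" if "u \<in> ?p ` ?X \<union> ?q ` ?Z" for u
          using that
        proof
          assume "u \<in> ?p ` ?X"
          then obtain x where "x \<in> ?X" "u = ?p x" by blast
          with * z0 show ?thesis by simp
        next
          assume "u \<in> ?q ` ?Z"
          with * x0 have "G u = G (?p x0)" by blast
          with * x0 z0 show ?thesis by simp
        qed
        then show "\<forall>u\<in>?p ` ?X \<union> ?q ` ?Z. \<forall>v\<in>?p ` ?X \<union> ?q ` ?Z. G u = G v"
          by simp
      qed
    qed blast
    also have "\<dots> \<longleftrightarrow> (\<forall>x\<in>?X. \<forall>z\<in>?Z. assoc_at x y z)"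
      using assoc_at_iff_both_regions[OF k _ l]
      by (intro ball_cong refl) (auto simp: M_l_def M_r_def)
    finally show ?thesis .
  qed
  have "?L \<longleftrightarrow> (\<forall>y\<in>M. \<forall>k\<in>K_ext K. \<forall>l\<in>K_ext K. J_set T M m b d k l y \<inter> (M - {m}) = {})"
    unfolding I3_def by blast
  also have "\<dots> \<longleftrightarrow> (\<forall>y\<in>M. \<forall>k\<in>K_ext K. \<forall>l\<in>K_ext K.
      \<forall>x\<in>M_l T M m b d k y. \<forall>z\<in>M_r T M m b d l y. assoc_at x y z)"
    using J by (intro ball_cong refl) auto
  also have "\<dots> \<longleftrightarrow> ?R"
  proof
    assume *: "\<forall>y\<in>M. \<forall>k\<in>K_ext K. \<forall>l\<in>K_ext K.
      \<forall>x\<in>M_l T M m b d k y. \<forall>z\<in>M_r T M m b d l y. assoc_at x y z"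
    show ?R
    proof (intro ballI impI)
      fix x y z assume xyz: "x \<in> M" "y \<in> M" "z \<in> M" "T x y \<notin> M - {m}" "T y z \<notin> M - {m}"
      then obtain k l where "k \<in> K_ext K" "T x y \<in> region M m b d k"
        and "l \<in> K_ext K" "T y z \<in> region M m b d l"
        using region_cover[OF T_unit] M_subset_unit by metis
      with * xyz show "assoc_at x y z"
        by (auto simp: M_l_def M_r_def)
    qed
  next
    assume ?R
    then show "\<forall>y\<in>M. \<forall>k\<in>K_ext K. \<forall>l\<in>K_ext K.
        \<forall>x\<in>M_l T M m b d k y. \<forall>z\<in>M_r T M m b d l y. assoc_at x y z"
      using region_avoids unfolding M_l_def M_r_def by blast
  qed
  finally show ?thesis .
qed

text \<open>Reversing the arguments of \<open>T\<close> exchanges \<open>I1\<close> and \<open>I2\<close>.\<close>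

lemma I2_avoids_iff:
  "I2 T M m K b d \<inter> (M - {m}) = {} \<longleftrightarrow>
     (\<forall>x\<in>M. \<forall>y\<in>M. \<forall>z\<in>M. T x y \<in> M - {m} \<longrightarrow> T y z \<notin> M - {m} \<longrightarrow> assoc_at x y z)"
proof -
  interpret opp: gap_system M m K b d "\<lambda>x y. T y x"
    by unfold_locales
      (use right_mem gap_disjoint gaps_cover T_unit T_assoc in \<open>auto simp del: atLeastAtMost_iff\<close>)
  have "I2 T M m K b d = I1 (\<lambda>x y. T y x) M m K b d"
    by (simp add: I1_def I2_def I_l_def I_r_def M_l_def M_r_def M_lower_def M_upper_def)
  moreover have "opp.assoc_at x y z \<longleftrightarrow> assoc_at z y x" for x y z
    by (auto simp: opp.assoc_at_def assoc_at_def otimes_def)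
  ultimately show ?thesis
    using opp.I1_avoids_iff by auto
qed

theorem semigroup_iff_I_set_avoids:
  "semigroup_on M (otimes T M m) \<longleftrightarrow> I_set T M m K b d \<inter> (M - {m}) = {}"
proof -
  have "semigroup_on M (otimes T M m) \<longleftrightarrow> (\<forall>x\<in>M. \<forall>y\<in>M. \<forall>z\<in>M. assoc_at x y z)"
    by (simp add: semigroup_on_def assoc_at_def otimes_def G_mem)
  also have "\<dots> \<longleftrightarrow> I1 T M m K b d \<inter> (M - {m}) = {} \<and> I2 T M m K b d \<inter> (M - {m}) = {}
      \<and> I3 T M m K b d \<inter> (M - {m}) = {}"
    unfolding I1_avoids_iff I2_avoids_iff I3_avoids_iff
    using assoc_at_if_products_mem by blast
  also have "\<dots> \<longleftrightarrow> I_set T M m K b d \<inter> (M - {m}) = {}"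
    unfolding I_set_def by blast
  finally show ?thesis .
qed

end

section \<open>Associated pairs\<close>

text \<open>
  If \<open>M\<close> is the whole interval \<open>[0, m]\<close>, its single degenerate interval has an empty region, so this
  case fits the same description.
\<close>

lemma associated_pair_gaps:
  assumes "associated_pair M m K b d C" "m \<in> M"
  shows "\<And>k. k \<in> K \<Longrightarrow> d k \<in> M"
    and "\<And>k. k \<in> K \<Longrightarrow> region M m b d (Some k) \<inter> M = {}"
    and "\<And>x. x \<in> {0..m} - M \<Longrightarrow> \<exists>k\<in>K. x \<in> region M m b d (Some k)"
proof -
  have "(\<forall>k\<in>K. d k \<in> M \<and> region M m b d (Some k) \<inter> M = {}) \<and>
      (\<forall>x\<in>{0..m} - M. \<exists>k\<in>K. x \<in> region M m b d (Some k))"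
  proof (cases "M = {0..m}")
    case True
    with assms show ?thesis
      by (auto simp: associated_pair_def region_def)
  next
    case False
    have C: "{b k..d k} \<inter> C = {d k} \<or> {b k..d k} \<inter> C = {b k, d k}" if "k \<in> K" for k
      using assms(1) False that by (simp add: associated_pair_def)
    have M: "M = C \<union> ({0..m} - (\<Union>k\<in>K. {b k..d k}))"
      using assms(1) False by (simp add: associated_pair_def)
    have right: "d k \<in> M" if "k \<in> K" for k
      using C[OF that] M by blast
    have ends: "x = b k \<or> x = d k" if "k \<in> K" "x \<in> {b k..d k}" "x \<in> M" for x k
      using C[OF that(1)] M that by blast
    have disj: "region M m b d (Some k) \<inter> M = {}" if "k \<in> K" for k
    proof (rule equals0I)
      fix x assume "x \<in> region M m b d (Some k) \<inter> M"
      then have "x \<in> {b k..d k}" "x \<in> M" "x \<noteq> d k" "x = b k \<longrightarrow> b k \<notin> M"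
        by (auto simp: region_def split: if_splits)
      with ends[OF that] show False by blast
    qed
    have "\<exists>k\<in>K. x \<in> region M m b d (Some k)" if x: "x \<in> {0..m} - M" for x
    proof -
      from x M obtain k where k: "k \<in> K" "x \<in> {b k..d k}" by blast
      moreover have "x \<noteq> d k"
        using x right[OF k(1)] by auto
      moreover have "x \<noteq> b k" if "b k \<in> M"
        using x that by auto
      ultimately show ?thesis
        by (intro bexI[of _ k]) (auto simp: region_def)
    qed
    with right disj show ?thesis by blast
  qed
  then show "\<And>k. k \<in> K \<Longrightarrow> d k \<in> M"
    and "\<And>k. k \<in> K \<Longrightarrow> region M m b d (Some k) \<inter> M = {}"
    and "\<And>x. x \<in> {0..m} - M \<Longrightarrow> \<exists>k\<in>K. x \<in> region M m b d (Some k)"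
    by blast+
qed

theorem theorem5p2:
  fixes T :: "real \<Rightarrow> real \<Rightarrow> real" and f :: "real \<Rightarrow> real"
    and M C :: "real set" and K :: "'k set" and b d :: "'k \<Rightarrow> real"
  assumes "\<And>x y. x \<in> {0..1} \<Longrightarrow> y \<in> {0..1} \<Longrightarrow> T x y \<in> {0..1}"
    and "\<And>x y z. x \<in> {0..1} \<Longrightarrow> y \<in> {0..1} \<Longrightarrow> z \<in> {0..1} \<Longrightarrow> T (T x y) z = T x (T y z)"
    and "monotone_op_on {0..1} T"
    and "\<exists>e. neutral_on {0..1} T e"
    and "nondecreasing_rcont f"
    and "\<not> f constant_on {0..1}"
    and "f 1 < 1"
    and "M = f ` {0..1}"
    and "associated_pair M (f 1) K b d C"
  shows "semigroup_on M (otimes T M (f 1)) \<longleftrightarrow>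
         I_set T M (f 1) K b d \<inter> (M - {f 1}) = {}"
proof -
  interpret inf_closed_set M "f 1"
    unfolding assms(8) using assms(5) by (rule inf_closed_set_range)
  interpret gap_system M "f 1" K b d T
    using associated_pair_gaps[OF assms(9) max_mem] assms(1,2) by unfold_locales
  show ?thesis by (rule semigroup_iff_I_set_avoids)
qed

end
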